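(* Let $(B_+,\mathcal C_+,B_-,\mathcal C_-;\mathsf{con}_1,\mathsf{tot}_1)$ be a presentation of a pre-d-frame and suppose it satisfies ($\lambda^4_+$), ($\lambda^4_-$), (ind$_+$) and (ind$_-$) below. Then the generated pre-d-frame $(L_+,L_-;\mathsf{Con}_*,\mathsf{Tot}_* )$ satisfies (con-tot): if $\alpha\in\mathsf{Con}_*$, $\beta\in\mathsf{Tot}_*$ and ($\alpha_+=\beta_+$ or $\alpha_-=\beta_-$) then $\alpha\sqsubseteq\beta$. ($\lambda^4_+$): $\alpha\in\mathsf{con}_{\wedge,\bigvee}$, $\beta\in\mathsf{tot}_\wedge$, $\beta_+\le\alpha_+$ imply $\alpha_-\le\beta_-$. ($\lambda^4_-$): $\alpha\in\mathsf{con}_{\vee,\bigwedge}$, $\beta\in\mathsf{tot}_\vee$, $\beta_-\le\alpha_-$ imply $\alpha_+\le\beta_+$. (ind$_+$): $(B_+\times B_-)\cap\downarrow\mathsf{con}_{\wedge,\bigvee}\subseteq\downarrow\mathsf{con}_{\wedge,\vee}$. (ind$_-$): $(B_+\times B_-)\cap\downarrow\mathsf{con}_{\vee,\bigwedge}\subseteq\downarrow\mathsf{con}_{\wedge,\vee}$.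
   Context: A frame presentation $(B,\mathcal C)$: $B$ a meet-semilattice with top, $\mathcal C$ a set of pairs $U\dashv a$ ($a\in B$, $U\subseteq\downarrow a$) with $U\dashv a\in\mathcal C$, $b\le a\Rightarrow\{u\wedge b:u\in U\}\dashv b\in\mathcal C$. $\mathcal C$-ideals are downsets $I\subseteq B$ with $U\dashv a\in\mathcal C,U\subseteq I\Rightarrow a\in I$; they form a frame under inclusion. A presentation of a pre-d-frame is $(B_+,\mathcal C_+,B_-,\mathcal C_-;\mathsf{con}_1,\mathsf{tot}_1)$ with $(B_\pm,\mathcal C_\pm)$ frame presentations and $\mathsf{con}_1,\mathsf{tot}_1\subseteq B_+\times B_-$. Let $L_\pm$ be the frame of $\mathcal C_\pm$-ideals; identify $b\in B_\pm$ with the smallest $\mathcal C_\pm$-ideal containing it, so $B_\pm\subseteq L_\pm$ and $\mathsf{con}_1,\mathsf{tot}_1\subseteq L_+\times L_-$. On $L_+\times L_-$: information order $\alpha\sqsubseteq\beta$ iff $\alpha_+\le\beta_+,\alpha_-\le\beta_-$; logical join $\alpha\vee\beta=(\alpha_+\vee\beta_+,\alpha_-\wedge\beta_-)$, logical meet $\alpha\wedge\beta=(\alpha_+\wedge\beta_+,\alpha_-\vee\beta_-)$; $tt=(1,0)$, $ff=(0,1)$. $\mathsf{Con}_*$ is the smallest relation containing $\mathsf{con}_1$, $tt,ff$ that is $\sqsubseteq$-downward closed and closed under logical $\wedge,\vee$ and coordinatewise joins of $\sqsubseteq$-directed sets; $\mathsf{Tot}_*$ the smallest containing $\mathsf{tot}_1$,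 $tt,ff$, $\sqsubseteq$-upward closed and closed under logical $\wedge,\vee$. $\mathsf{con}_\wedge$, $\mathsf{con}_\vee$, $\mathsf{con}_{\wedge,\vee}$ denote the closures of $\mathsf{con}_1$ under all finite logical meets, finite logical joins, and both, respectively (similarly $\mathsf{tot}_\wedge,\mathsf{tot}_\vee$). $\mathsf{con}_{\wedge,\bigvee}=\{(\bigvee_i\alpha^i_+,\bigwedge_i\alpha^i_-):\{\alpha^i\}_i\subseteq\mathsf{con}_\wedge\}$ (arbitrary families) and $\mathsf{con}_{\vee,\bigwedge}=\{(\bigwedge_i\alpha^i_+,\bigvee_i\alpha^i_-):\{\alpha^i\}_i\subseteq\mathsf{con}_\vee\}$. $\downarrow R$ is the $\sqsubseteq$-downward closure. *)

theory Defs
  imports Main "HOL.Hull"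
begin

text \<open>
  A meet-semilattice with top is a type of class \<^class>\<open>bounded_semilattice_inf_top\<close>;
  a cover \<open>U \<stileturn> a\<close> is a pair \<open>(U, a)\<close>.
\<close>

locale frame_presentation =
  fixes C :: "('a::bounded_semilattice_inf_top set \<times> 'a) set"
  assumes cover_below: "(U, a) \<in> C \<Longrightarrow> u \<in> U \<Longrightarrow> u \<le> a"
    and cover_stable: "(U, a) \<in> C \<Longrightarrow> b \<le> a \<Longrightarrow> ((\<lambda>u. inf u b) ` U, b) \<in> C"

definition c_ideal :: "('a::bounded_semilattice_inf_top set \<times> 'a) set \<Rightarrow> 'a set \<Rightarrow> bool" where
  "c_ideal C I \<longleftrightarrow>
     (\<forall>x\<in>I. \<forall>y. y \<le> x \<longrightarrow> y \<in> I) \<and> (\<forall>(U, a)\<in>C. U \<subseteq> I \<longrightarrow> a \<in> I)"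

lemma c_ideal_downD: "c_ideal C I \<Longrightarrow> x \<in> I \<Longrightarrow> y \<le> x \<Longrightarrow> y \<in> I"
  unfolding c_ideal_def by blast

lemma c_ideal_coverD: "c_ideal C I \<Longrightarrow> (U, a) \<in> C \<Longrightarrow> U \<subseteq> I \<Longrightarrow> a \<in> I"
  unfolding c_ideal_def by blast

lemma c_idealI:
  assumes "\<And>x y. x \<in> I \<Longrightarrow> y \<le> x \<Longrightarrow> y \<in> I"
    and "\<And>U a. (U, a) \<in> C \<Longrightarrow> U \<subseteq> I \<Longrightarrow> a \<in> I"
  shows "c_ideal C I"
  using assms unfolding c_ideal_def by blast

text \<open>
  The frame of \<open>C\<close>-ideals is ordered by inclusion. Its meets are intersections (the empty one being
  \<^term>\<open>UNIV\<close>), its joins are the \<open>C\<close>-ideals generated by unions; see \<open>c_ideal_Inter\<close>,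
  \<open>c_Sup_least\<close> and \<open>c_Sup_distrib\<close> below.
\<close>

definition c_ideals :: "('a::bounded_semilattice_inf_top set \<times> 'a) set \<Rightarrow> 'a set set" where
  "c_ideals C = {I. c_ideal C I}"

definition c_Sup :: "('a::bounded_semilattice_inf_top set \<times> 'a) set \<Rightarrow> 'a set set \<Rightarrow> 'a set" where
  "c_Sup C F = c_ideal C hull (\<Union>F)"

definition c_emb :: "('a::bounded_semilattice_inf_top set \<times> 'a) set \<Rightarrow> 'a \<Rightarrow> 'a set" where
  "c_emb C b = c_ideal C hull {b}"

lemma c_ideal_Inter: "(\<And>I. I \<in> F \<Longrightarrow> c_ideal C I) \<Longrightarrow> c_ideal C (\<Inter>F)"
  unfolding c_ideal_def by fast

lemma c_ideal_hull: "c_ideal C (c_ideal C hull S)"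
  unfolding hull_def by (rule c_ideal_Inter) simp

lemma c_ideal_Sup: "c_ideal C (c_Sup C F)"
  unfolding c_Sup_def by (rule c_ideal_hull)

lemma c_Sup_upper: "I \<in> F \<Longrightarrow> I \<subseteq> c_Sup C F"
  unfolding c_Sup_def by (rule order_trans[OF Union_upper hull_subset])

lemma c_Sup_least: "c_ideal C J \<Longrightarrow> (\<And>I. I \<in> F \<Longrightarrow> I \<subseteq> J) \<Longrightarrow> c_Sup C F \<subseteq> J"
  unfolding c_Sup_def unfolding hull_def by blast

lemma (in frame_presentation) c_Sup_distrib:
  assumes I: "c_ideal C I" and F: "\<And>K. K \<in> F \<Longrightarrow> c_ideal C K"
  shows "I \<inter> c_Sup C F = c_Sup C ((\<lambda>K. I \<inter> K) ` F)" (is "_ = ?H")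
proof
  have H: "c_ideal C ?H" by (rule c_ideal_Sup)
  define J where "J = {x. \<forall>i\<in>I. inf x i \<in> ?H}"
  have "c_ideal C J"
  proof (rule c_idealI)
    fix x y assume x: "x \<in> J" and yx: "y \<le> x"
    have "inf y i \<in> ?H" if "i \<in> I" for i
      by (rule c_ideal_downD[OF H _ inf_mono[OF yx order_refl]]) (use x that in \<open>simp add: J_def\<close>)
    then show "y \<in> J" by (simp add: J_def)
  next
    fix U a assume Ua: "(U, a) \<in> C" and U: "U \<subseteq> J"
    show "a \<in> J"
      unfolding J_def
    proof (intro CollectI ballI)
      fix i assume i: "i \<in> I"
      have cov: "((\<lambda>u. inf u (inf a i)) ` U, inf a i) \<in> C"
        by (rule cover_stable[OF Ua inf_le1])
      have "inf u (inf a i) \<in> ?H" if u: "u \<in> U" for u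
      proof -
        have "inf u i \<in> ?H" using u U i unfolding J_def by auto
        then show ?thesis
          by (rule c_ideal_downD[OF H _ inf_mono[OF order_refl inf_le2]])
      qed
      then show "inf a i \<in> ?H"
        by (intro c_ideal_coverD[OF H cov]) (rule image_subsetI)
    qed
  qed
  moreover have "K \<subseteq> J" if K: "K \<in> F" for K
  proof
    fix x assume x: "x \<in> K"
    have "inf x i \<in> I \<inter> K" if "i \<in> I" for i
      using c_ideal_downD[OF I that inf_le2] c_ideal_downD[OF F[OF K] x inf_le1] by (rule IntI)
    then show "x \<in> J"
      unfolding J_def using c_Sup_upper[OF imageI[OF K]] by (intro CollectI ballI) (rule subsetD)
  qed
  ultimately have "c_Sup C F \<subseteq> J" by (rule c_Sup_least)
  then have "inf x x \<in> ?H" if "x \<in> I" "x \<in> c_Sup C F" for x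
    using that unfolding J_def by blast
  then show "I \<inter> c_Sup C F \<subseteq> ?H" by auto
  have "c_ideal C (\<Inter>{I, c_Sup C F})"
    using I c_ideal_Sup by (intro c_ideal_Inter) auto
  then have "c_ideal C (I \<inter> c_Sup C F)" by simp
  moreover have "I \<inter> K \<subseteq> I \<inter> c_Sup C F" if "K \<in> F" for K
    using c_Sup_upper[OF that] by (rule Int_mono[OF order_refl])
  ultimately show "?H \<subseteq> I \<inter> c_Sup C F"
    by (intro c_Sup_least) (assumption, erule imageE, simp only:)
qed

type_synonym ('a, 'b) dpair = "'a set \<times> 'b set"

definition info_le :: "('a, 'b) dpair \<Rightarrow> ('a, 'b) dpair \<Rightarrow> bool"  (infix "\<sqsubseteq>" 50) where
  "\<alpha> \<sqsubseteq> \<beta> \<longleftrightarrow> fst \<alpha> \<subseteq> fst \<beta> \<and> snd \<alpha> \<subseteq> snd \<beta>"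

definition info_directed :: "('a, 'b) dpair set \<Rightarrow> bool" where
  "info_directed D \<longleftrightarrow> D \<noteq> {} \<and> (\<forall>\<alpha>\<in>D. \<forall>\<beta>\<in>D. \<exists>\<gamma>\<in>D. \<alpha> \<sqsubseteq> \<gamma> \<and> \<beta> \<sqsubseteq> \<gamma>)"

context
  fixes Cp :: "('a::bounded_semilattice_inf_top set \<times> 'a) set"
    and Cm :: "('b::bounded_semilattice_inf_top set \<times> 'b) set"
begin

definition log_join :: "('a, 'b) dpair \<Rightarrow> ('a, 'b) dpair \<Rightarrow> ('a, 'b) dpair" where
  "log_join \<alpha> \<beta> = (c_Sup Cp {fst \<alpha>, fst \<beta>}, snd \<alpha> \<inter> snd \<beta>)"

definition log_meet :: "('a, 'b) dpair \<Rightarrow> ('a, 'b) dpair \<Rightarrow> ('a, 'b) dpair" where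
  "log_meet \<alpha> \<beta> = (fst \<alpha> \<inter> fst \<beta>, c_Sup Cm {snd \<alpha>, snd \<beta>})"

definition tt :: "('a, 'b) dpair" where "tt = (UNIV, c_Sup Cm {})"

definition ff :: "('a, 'b) dpair" where "ff = (c_Sup Cp {}, UNIV)"

definition dpairs :: "('a, 'b) dpair set" where
  "dpairs = c_ideals Cp \<times> c_ideals Cm"

definition emb_rel :: "('a \<times> 'b) set \<Rightarrow> ('a, 'b) dpair set" where
  "emb_rel R = map_prod (c_emb Cp) (c_emb Cm) ` R"

definition info_down :: "('a, 'b) dpair set \<Rightarrow> ('a, 'b) dpair set" where
  "info_down R = {\<alpha>\<in>dpairs. \<exists>\<beta>\<in>R. \<alpha> \<sqsubseteq> \<beta>}"

inductive_set Con :: "('a \<times> 'b) set \<Rightarrow> ('a, 'b) dpair set" for con1 where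
  gen: "\<alpha> \<in> emb_rel con1 \<Longrightarrow> \<alpha> \<in> Con con1"
| tt: "tt \<in> Con con1"
| ff: "ff \<in> Con con1"
| down: "\<beta> \<in> Con con1 \<Longrightarrow> \<alpha> \<in> dpairs \<Longrightarrow> \<alpha> \<sqsubseteq> \<beta> \<Longrightarrow> \<alpha> \<in> Con con1"
| meet: "\<alpha> \<in> Con con1 \<Longrightarrow> \<beta> \<in> Con con1 \<Longrightarrow> log_meet \<alpha> \<beta> \<in> Con con1"
| join: "\<alpha> \<in> Con con1 \<Longrightarrow> \<beta> \<in> Con con1 \<Longrightarrow> log_join \<alpha> \<beta> \<in> Con con1"
| directed: "(\<And>\<delta>. \<delta> \<in> D \<Longrightarrow> \<delta> \<in> Con con1) \<Longrightarrow> info_directed D \<Longrightarrow>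
    (c_Sup Cp (fst ` D), c_Sup Cm (snd ` D)) \<in> Con con1"

inductive_set Tot :: "('a \<times> 'b) set \<Rightarrow> ('a, 'b) dpair set" for tot1 where
  gen: "\<alpha> \<in> emb_rel tot1 \<Longrightarrow> \<alpha> \<in> Tot tot1"
| tt: "tt \<in> Tot tot1"
| ff: "ff \<in> Tot tot1"
| up: "\<beta> \<in> Tot tot1 \<Longrightarrow> \<alpha> \<in> dpairs \<Longrightarrow> \<beta> \<sqsubseteq> \<alpha> \<Longrightarrow> \<alpha> \<in> Tot tot1"
| meet: "\<alpha> \<in> Tot tot1 \<Longrightarrow> \<beta> \<in> Tot tot1 \<Longrightarrow> log_meet \<alpha> \<beta> \<in> Tot tot1"
| join: "\<alpha> \<in> Tot tot1 \<Longrightarrow> \<beta> \<in> Tot tot1 \<Longrightarrow> log_join \<alpha> \<beta> \<in> Tot tot1"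

text \<open>
  Closures under finite logical meets and joins, the empty meet being \<^const>\<open>tt\<close> and the
  empty join \<^const>\<open>ff\<close>.
\<close>

inductive_set meet_cl :: "('a \<times> 'b) set \<Rightarrow> ('a, 'b) dpair set" for R where
  gen: "\<alpha> \<in> emb_rel R \<Longrightarrow> \<alpha> \<in> meet_cl R"
| tt: "tt \<in> meet_cl R"
| meet: "\<alpha> \<in> meet_cl R \<Longrightarrow> \<beta> \<in> meet_cl R \<Longrightarrow> log_meet \<alpha> \<beta> \<in> meet_cl R"

inductive_set join_cl :: "('a \<times> 'b) set \<Rightarrow> ('a, 'b) dpair set" for R where
  gen: "\<alpha> \<in> emb_rel R \<Longrightarrow> \<alpha> \<in> join_cl R"
| ff: "ff \<in> join_cl R"
| join: "\<alpha> \<in> join_cl R \<Longrightarrow> \<beta> \<in> join_cl R \<Longrightarrow> log_join \<alpha> \<beta> \<in> join_cl R"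

inductive_set meet_join_cl :: "('a \<times> 'b) set \<Rightarrow> ('a, 'b) dpair set" for R where
  gen: "\<alpha> \<in> emb_rel R \<Longrightarrow> \<alpha> \<in> meet_join_cl R"
| tt: "tt \<in> meet_join_cl R"
| ff: "ff \<in> meet_join_cl R"
| meet: "\<alpha> \<in> meet_join_cl R \<Longrightarrow> \<beta> \<in> meet_join_cl R \<Longrightarrow> log_meet \<alpha> \<beta> \<in> meet_join_cl R"
| join: "\<alpha> \<in> meet_join_cl R \<Longrightarrow> \<beta> \<in> meet_join_cl R \<Longrightarrow> log_join \<alpha> \<beta> \<in> meet_join_cl R"

definition meet_Join_cl :: "('a \<times> 'b) set \<Rightarrow> ('a, 'b) dpair set" where
  "meet_Join_cl R = {(c_Sup Cp (fst ` A), \<Inter>(snd ` A)) | A. A \<subseteq> meet_cl R}"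

definition join_Meet_cl :: "('a \<times> 'b) set \<Rightarrow> ('a, 'b) dpair set" where
  "join_Meet_cl R = {(\<Inter>(fst ` A), c_Sup Cm (snd ` A)) | A. A \<subseteq> join_cl R}"

end

end

theory Submission
  imports Defs
begin

text \<open>
  Call \<open>(x, y)\<close> consistent if it lies below an element of the finite closure of \<open>con1\<close>. Rewriting
  finite combinations as joins of meets (or dually), the hypotheses (ind) ensure that for fixed
  \<open>y\<close> the consistent \<open>x\<close> form an ideal, and symmetrically. Hence the pairs \<open>\<alpha>\<close> of ideals with
  \<open>fst \<alpha> \<times> snd \<alpha>\<close> consistent are closed under all operations that generate \<^const>\<open>Con\<close>. For such
  an \<open>\<alpha>\<close> and \<open>y \<in> snd \<alpha>\<close>, joining the witnesses of all \<open>(x, y)\<close> with \<open>x \<in> fst \<alpha>\<close> produces an element of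
  \<^const>\<open>meet_Join_cl\<close> above \<open>fst \<alpha>\<close> whose second component still contains \<open>y\<close>, so that
  the hypothesis (lambda) applies. Elements of \<^const>\<open>Tot\<close> reduce to finite meets because they lie above a
  finite join of these.
\<close>

section \<open>Lattice operations on ideals\<close>

lemma c_ideal_Int: "c_ideal C I \<Longrightarrow> c_ideal C J \<Longrightarrow> c_ideal C (I \<inter> J)"
  using c_ideal_Inter[of "{I, J}" C] by auto

lemma c_ideal_UNIV: "c_ideal C UNIV"
  by (simp add: c_ideal_def)

lemma c_ideal_emb: "c_ideal C (c_emb C b)"
  unfolding c_emb_def by (rule c_ideal_hull)

lemma c_emb_subset_iff: "c_ideal C I \<Longrightarrow> c_emb C b \<subseteq> I \<longleftrightarrow> b \<in> I"
  unfolding c_emb_def hull_def by blast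

lemma c_Sup_subset_iff: "c_ideal C J \<Longrightarrow> c_Sup C F \<subseteq> J \<longleftrightarrow> (\<forall>I\<in>F. I \<subseteq> J)"
  by (meson c_Sup_least c_Sup_upper subset_trans)

lemma c_Sup_mono: "(\<And>I. I \<in> F \<Longrightarrow> \<exists>J\<in>G. I \<subseteq> J) \<Longrightarrow> c_Sup C F \<subseteq> c_Sup C G"
  by (meson c_Sup_least c_Sup_upper c_ideal_Sup subset_trans)

lemma c_Sup_singleton: "c_ideal C I \<Longrightarrow> c_Sup C {I} = I"
  by (simp add: c_Sup_subset_iff c_Sup_upper subset_antisym)

lemma c_Sup_pair_upper: "I \<subseteq> c_Sup C {I, J}" "J \<subseteq> c_Sup C {I, J}"
  by (simp_all add: c_Sup_upper)

lemma c_Sup_empty_Int: "c_ideal C I \<Longrightarrow> c_Sup C {} \<inter> I = c_Sup C {}"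
  by (simp add: Int_absorb2 c_Sup_subset_iff)

lemma c_Sup_UNIV: "c_Sup C {UNIV, I} = UNIV"
  using c_Sup_pair_upper(1)[of UNIV C I] by blast

context frame_presentation
begin

lemma c_Sup_pair_Int:
  assumes "c_ideal C I" "c_ideal C J" "c_ideal C K"
  shows "c_Sup C {I, J} \<inter> K = c_Sup C {I \<inter> K, J \<inter> K}"
  using c_Sup_distrib[of K "{I, J}"] assms by (auto simp: Int_commute)

text \<open>The dual distributive law, derived as in any distributive lattice: expanding the
  right-hand side gives the join of \<open>I \<inter> J\<close> with terms contained in
  \<open>K\<close>, which \<open>K\<close> absorbs.\<close>

lemma c_Sup_Int_pair:
  assumes I: "c_ideal C I" and J: "c_ideal C J" and K: "c_ideal C K"
  shows "c_Sup C {I \<inter> J, K} = c_Sup C {I, K} \<inter> c_Sup C {J, K}" (is "?L = ?R")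
proof
  show "?L \<subseteq> ?R"
    by (intro Int_greatest c_Sup_mono) auto
  have "?R = c_Sup C {I \<inter> c_Sup C {J, K}, K \<inter> c_Sup C {J, K}}"
    by (intro c_Sup_pair_Int I K c_ideal_Sup)
  also have "I \<inter> c_Sup C {J, K} = c_Sup C {J \<inter> I, K \<inter> I}"
    using c_Sup_pair_Int[OF J K I] by (simp add: Int_commute)
  finally show "?R \<subseteq> ?L"
    using c_Sup_pair_upper(1)[of "I \<inter> J" C K] c_Sup_pair_upper(2)[of K C "I \<inter> J"]
    by (auto simp: c_Sup_subset_iff c_ideal_Sup)
qed

end

section \<open>Pairs of ideals and their logical operations\<close>

lemma dpairs_iff: "\<alpha> \<in> dpairs Cp Cm \<longleftrightarrow> c_ideal Cp (fst \<alpha>) \<and> c_ideal Cm (snd \<alpha>)"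
  by (auto simp: dpairs_def c_ideals_def mem_Times_iff)

lemma emb_rel_dpairs: "\<alpha> \<in> emb_rel Cp Cm R \<Longrightarrow> \<alpha> \<in> dpairs Cp Cm"
  by (auto simp: emb_rel_def dpairs_iff c_ideal_emb)

lemma tt_dpairs: "tt Cm \<in> dpairs Cp Cm"
  by (simp add: tt_def dpairs_iff c_ideal_UNIV c_ideal_Sup)

lemma ff_dpairs: "ff Cp \<in> dpairs Cp Cm"
  by (simp add: ff_def dpairs_iff c_ideal_UNIV c_ideal_Sup)

lemma log_meet_dpairs:
  "\<alpha> \<in> dpairs Cp Cm \<Longrightarrow> \<beta> \<in> dpairs Cp Cm \<Longrightarrow> log_meet Cm \<alpha> \<beta> \<in> dpairs Cp Cm"
  by (simp add: log_meet_def dpairs_iff c_ideal_Int c_ideal_Sup)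

lemma log_join_dpairs:
  "\<alpha> \<in> dpairs Cp Cm \<Longrightarrow> \<beta> \<in> dpairs Cp Cm \<Longrightarrow> log_join Cp \<alpha> \<beta> \<in> dpairs Cp Cm"
  by (simp add: log_join_def dpairs_iff c_ideal_Int c_ideal_Sup)

lemmas dpairs_intros =
  emb_rel_dpairs tt_dpairs ff_dpairs log_meet_dpairs log_join_dpairs

lemma log_meet_mono:
  "\<alpha> \<sqsubseteq> \<alpha>' \<Longrightarrow> \<beta> \<sqsubseteq> \<beta>' \<Longrightarrow> log_meet Cm \<alpha> \<beta> \<sqsubseteq> log_meet Cm \<alpha>' \<beta>'"
  unfolding info_le_def log_meet_def fst_conv snd_conv
  by (intro conjI Int_mono c_Sup_mono) auto

lemma log_join_mono:
  "\<alpha> \<sqsubseteq> \<alpha>' \<Longrightarrow> \<beta> \<sqsubseteq> \<beta>' \<Longrightarrow> log_join Cp \<alpha> \<beta> \<sqsubseteq> log_join Cp \<alpha>' \<beta>'"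
  unfolding info_le_def log_join_def fst_conv snd_conv
  by (intro conjI Int_mono c_Sup_mono) auto

lemma info_le_refl: "\<alpha> \<sqsubseteq> \<alpha>"
  by (simp add: info_le_def)

lemma info_le_trans: "\<alpha> \<sqsubseteq> \<beta> \<Longrightarrow> \<beta> \<sqsubseteq> \<gamma> \<Longrightarrow> \<alpha> \<sqsubseteq> \<gamma>"
  by (auto simp: info_le_def)

lemma meet_cl_dpairs: "\<alpha> \<in> meet_cl Cp Cm R \<Longrightarrow> \<alpha> \<in> dpairs Cp Cm"
  by (induction rule: meet_cl.induct) (auto intro: dpairs_intros)

lemma meet_join_cl_dpairs: "\<alpha> \<in> meet_join_cl Cp Cm R \<Longrightarrow> \<alpha> \<in> dpairs Cp Cm"
  by (induction rule: meet_join_cl.induct) (auto intro: dpairs_intros)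

lemma meet_Join_cl_dpairs:
  assumes "\<alpha> \<in> meet_Join_cl Cp Cm R"
  shows "\<alpha> \<in> dpairs Cp Cm"
proof -
  obtain A where A: "\<alpha> = (c_Sup Cp (fst ` A), \<Inter>(snd ` A))" "A \<subseteq> meet_cl Cp Cm R"
    using assms by (auto simp: meet_Join_cl_def)
  have "c_ideal Cm (\<Inter>(snd ` A))"
    using A(2) meet_cl_dpairs[of _ Cp Cm R] unfolding dpairs_iff
    by (intro c_ideal_Inter) blast
  then show ?thesis
    by (simp add: A(1) dpairs_iff c_ideal_Sup)
qed

text \<open>Translates the hypotheses (ind), which speak of pairs of embedded generators, into
  membership of elements: the embedded generator is the least ideal containing the element.\<close>

lemma emb_mem_info_down_iff:
  assumes "S \<subseteq> dpairs Cp Cm"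
  shows "(c_emb Cp x, c_emb Cm y) \<in> info_down Cp Cm S \<longleftrightarrow> (\<exists>\<gamma>\<in>S. x \<in> fst \<gamma> \<and> y \<in> snd \<gamma>)"
proof -
  have "(c_emb Cp x, c_emb Cm y) \<sqsubseteq> \<gamma> \<longleftrightarrow> x \<in> fst \<gamma> \<and> y \<in> snd \<gamma>" if "\<gamma> \<in> S" for \<gamma>
    using subsetD[OF assms that] by (simp add: info_le_def dpairs_iff c_emb_subset_iff)
  then show ?thesis
    by (auto simp: info_down_def dpairs_iff c_ideal_emb)
qed


subsection \<open>Disjunctive normal forms\<close>

text \<open>Finite logical joins of finite logical meets, with \<open>ff\<close> as the empty join.
  This normal form links the finite closure to \<open>meet_Join_cl\<close>, where only joins are
  taken outside the meets.\<close>

inductive_set dnf_cl ::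
  "('a::bounded_semilattice_inf_top set \<times> 'a) set \<Rightarrow> ('b::bounded_semilattice_inf_top set \<times> 'b) set
    \<Rightarrow> ('a \<times> 'b) set \<Rightarrow> ('a, 'b) dpair set"
  for Cp Cm R where
  base: "\<alpha> \<in> meet_cl Cp Cm R \<Longrightarrow> \<alpha> \<in> dnf_cl Cp Cm R"
| ff: "ff Cp \<in> dnf_cl Cp Cm R"
| join: "\<alpha> \<in> dnf_cl Cp Cm R \<Longrightarrow> \<beta> \<in> dnf_cl Cp Cm R \<Longrightarrow> log_join Cp \<alpha> \<beta> \<in> dnf_cl Cp Cm R"

lemma dnf_cl_dpairs: "\<alpha> \<in> dnf_cl Cp Cm R \<Longrightarrow> \<alpha> \<in> dpairs Cp Cm"
  by (induction rule: dnf_cl.induct) (auto intro: dpairs_intros meet_cl_dpairs)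

lemma log_meet_commute: "log_meet Cm \<alpha> \<beta> = log_meet Cm \<beta> \<alpha>"
  by (simp add: log_meet_def Int_commute insert_commute)

lemma log_meet_ff: "\<alpha> \<in> dpairs Cp Cm \<Longrightarrow> log_meet Cm (ff Cp) \<alpha> = ff Cp"
  by (simp add: log_meet_def ff_def dpairs_iff c_Sup_empty_Int c_Sup_UNIV)

text \<open>The first components agree by distributivity of meets over joins, the second ones by the
  dual law.\<close>

lemma log_meet_log_join:
  assumes "frame_presentation Cp" "frame_presentation Cm"
    and "\<alpha> \<in> dpairs Cp Cm" "\<beta> \<in> dpairs Cp Cm" "\<gamma> \<in> dpairs Cp Cm"
  shows "log_meet Cm (log_join Cp \<alpha> \<beta>) \<gamma> = log_join Cp (log_meet Cm \<alpha> \<gamma>) (log_meet Cm \<beta> \<gamma>)"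
  using assms
  by (simp add: log_meet_def log_join_def dpairs_iff frame_presentation.c_Sup_pair_Int
      frame_presentation.c_Sup_Int_pair)

text \<open>Distributivity moves joins outwards, first those of \<open>\<alpha>\<close>, then those
  of \<open>\<beta>\<close>; \<open>ff\<close> is absorbing for logical meets, so empty joins cause
  no exception.\<close>

lemma dnf_cl_meet:
  assumes fp: "frame_presentation Cp" "frame_presentation Cm"
    and \<alpha>: "\<alpha> \<in> dnf_cl Cp Cm R" and \<beta>: "\<beta> \<in> dnf_cl Cp Cm R"
  shows "log_meet Cm \<alpha> \<beta> \<in> dnf_cl Cp Cm R"
  using \<alpha>
proof induction
  case (base \<alpha>)
  from \<beta> show ?case
  proof induction
    case (base \<beta>)
    then show ?case
      using \<open>\<alpha> \<in> meet_cl Cp Cm R\<close> by (intro dnf_cl.base meet_cl.meet)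
  next
    case ff
    show ?case
      using log_meet_ff[OF meet_cl_dpairs[OF base]] dnf_cl.ff by (metis log_meet_commute)
  next
    case (join \<beta> \<gamma>)
    then show ?case
      unfolding log_meet_commute[of Cm \<alpha>]
      by (simp add: log_meet_log_join[OF fp dnf_cl_dpairs dnf_cl_dpairs meet_cl_dpairs[OF base]]
          dnf_cl.join)
  qed
next
  case ff
  show ?case
    by (simp add: log_meet_ff[OF dnf_cl_dpairs[OF \<beta>]] dnf_cl.ff)
next
  case (join \<alpha> \<alpha>')
  then show ?case
    by (simp add: log_meet_log_join[OF fp dnf_cl_dpairs dnf_cl_dpairs dnf_cl_dpairs[OF \<beta>]]
        dnf_cl.join)
qed

lemma meet_join_cl_subset_dnf_cl:
  assumes fp: "frame_presentation Cp" "frame_presentation Cm"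
  shows "meet_join_cl Cp Cm R \<subseteq> dnf_cl Cp Cm R"
proof
  fix \<alpha> assume "\<alpha> \<in> meet_join_cl Cp Cm R"
  then show "\<alpha> \<in> dnf_cl Cp Cm R"
    by induction (auto intro: dnf_cl.intros meet_cl.intros dnf_cl_meet[OF fp])
qed

text \<open>Upward closure can be postponed to the very end, because the logical operations are
  monotone in the information order.\<close>

lemma Tot_above_dnf_cl:
  assumes fp: "frame_presentation Cp" "frame_presentation Cm"
    and "\<beta> \<in> Tot Cp Cm R"
  shows "\<exists>\<gamma>\<in>dnf_cl Cp Cm R. \<gamma> \<sqsubseteq> \<beta>"
  using assms(3)
proof induction
  case (gen \<alpha>)
  then show ?case by (meson dnf_cl.base meet_cl.gen info_le_refl)
next
  case tt
  then show ?case by (meson dnf_cl.base meet_cl.tt info_le_refl)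
next
  case ff
  then show ?case by (meson dnf_cl.ff info_le_refl)
next
  case (up \<beta> \<alpha>)
  then show ?case by (meson info_le_trans)
next
  case (meet \<alpha> \<beta>)
  then show ?case by (meson dnf_cl_meet[OF fp] log_meet_mono)
next
  case (join \<alpha> \<beta>)
  then show ?case by (meson dnf_cl.join log_join_mono)
qed

text \<open>A join of joins is the join over the union of the families. The empty \<open>X\<close>
  is included and gives \<open>ff\<close>.\<close>

lemma meet_Join_cl_Join:
  assumes "X \<subseteq> meet_Join_cl Cp Cm R"
  shows "(c_Sup Cp (fst ` X), \<Inter>(snd ` X)) \<in> meet_Join_cl Cp Cm R"
proof -
  \<comment> \<open>Choose for every \<open>\<xi>\<close> one family \<open>f \<xi>\<close> of
    finite meets that represents it.\<close>
  have "\<forall>\<xi>\<in>X. \<exists>A. A \<subseteq> meet_cl Cp Cm R \<and> \<xi> = (c_Sup Cp (fst ` A), \<Inter>(snd ` A))"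
    using assms unfolding meet_Join_cl_def by blast
  then obtain f where f: "\<And>\<xi>. \<xi> \<in> X \<Longrightarrow> f \<xi> \<subseteq> meet_cl Cp Cm R"
      "\<And>\<xi>. \<xi> \<in> X \<Longrightarrow> \<xi> = (c_Sup Cp (fst ` f \<xi>), \<Inter>(snd ` f \<xi>))"
    by metis
  let ?A = "\<Union>(f ` X)"
  have fst_eq: "fst \<xi> = c_Sup Cp (fst ` f \<xi>)" and snd_eq: "snd \<xi> = \<Inter>(snd ` f \<xi>)" if "\<xi> \<in> X" for \<xi>
    using f(2)[OF that] by (metis fst_conv, metis snd_conv)
  have "c_Sup Cp (fst ` X) = c_Sup Cp (fst ` ?A)"
  proof
    have "fst \<xi> \<subseteq> c_Sup Cp (fst ` ?A)" if "\<xi> \<in> X" for \<xi>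
      unfolding fst_eq[OF that] using that by (intro c_Sup_mono) blast
    then show "c_Sup Cp (fst ` X) \<subseteq> c_Sup Cp (fst ` ?A)"
      by (simp add: c_Sup_subset_iff c_ideal_Sup)
    have "fst \<alpha> \<subseteq> fst \<xi>" if "\<xi> \<in> X" "\<alpha> \<in> f \<xi>" for \<alpha> \<xi>
      unfolding fst_eq[OF that(1)] using that(2) by (intro c_Sup_upper imageI)
    then show "c_Sup Cp (fst ` ?A) \<subseteq> c_Sup Cp (fst ` X)"
      by (intro c_Sup_mono) blast
  qed
  moreover have "\<Inter>(snd ` X) = \<Inter>(snd ` ?A)"
  proof -
    have "snd ` X = (\<lambda>\<xi>. \<Inter>(snd ` f \<xi>)) ` X"
      by (rule image_cong[OF refl snd_eq])
    then show ?thesis by auto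
  qed
  moreover have "?A \<subseteq> meet_cl Cp Cm R"
    using f(1) by blast
  ultimately show ?thesis
    unfolding meet_Join_cl_def by blast
qed

lemma dnf_cl_subset_meet_Join_cl: "dnf_cl Cp Cm R \<subseteq> meet_Join_cl Cp Cm R"
proof
  fix \<alpha> assume "\<alpha> \<in> dnf_cl Cp Cm R"
  then show "\<alpha> \<in> meet_Join_cl Cp Cm R"
  proof induction
    case (base \<alpha>)
    then have "\<alpha> = (c_Sup Cp (fst ` {\<alpha>}), \<Inter>(snd ` {\<alpha>}))"
      using meet_cl_dpairs[OF base] by (simp add: dpairs_iff c_Sup_singleton)
    then show ?case
      unfolding meet_Join_cl_def using base by blast
  next
    case ff
    show ?case
      using meet_Join_cl_Join[of "{}" Cp Cm R] by (simp add: ff_def)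
  next
    case (join \<alpha> \<beta>)
    then show ?case
      using meet_Join_cl_Join[of "{\<alpha>, \<beta>}" Cp Cm R] by (simp add: log_join_def)
  qed
qed


subsection \<open>Exchanging the two components\<close>

text \<open>Swapping components exchanges logical meets with joins and \<open>tt\<close> with
  \<open>ff\<close>, but keeps the information order (\<open>swap_info_le\<close>). So statements
  about one side transfer to the other.\<close>

lemma swap_simps:
  "prod.swap (tt Cm) = ff Cm" "prod.swap (ff Cp) = tt Cp"
  "prod.swap (log_meet Cm \<alpha> \<beta>) = log_join Cm (prod.swap \<alpha>) (prod.swap \<beta>)"
  "prod.swap (log_join Cp \<alpha> \<beta>) = log_meet Cp (prod.swap \<alpha>) (prod.swap \<beta>)"
  by (simp_all add: tt_def ff_def log_meet_def log_join_def)

lemma swap_emb_rel: "\<alpha> \<in> emb_rel Cp Cm R \<Longrightarrow> prod.swap \<alpha> \<in> emb_rel Cm Cp (R\<inverse>)"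
  by (force simp: emb_rel_def)

lemma swap_dpairs: "\<alpha> \<in> dpairs Cp Cm \<Longrightarrow> prod.swap \<alpha> \<in> dpairs Cm Cp"
  by (simp add: dpairs_iff)

lemma swap_info_le: "prod.swap \<alpha> \<sqsubseteq> prod.swap \<beta> \<longleftrightarrow> \<alpha> \<sqsubseteq> \<beta>"
  by (auto simp: info_le_def)

lemma swap_meet_cl: "\<alpha> \<in> meet_cl Cp Cm R \<Longrightarrow> prod.swap \<alpha> \<in> join_cl Cm Cp (R\<inverse>)"
  by (induction rule: meet_cl.induct) (auto simp: swap_simps intro: join_cl.intros swap_emb_rel)

lemma swap_meet_join_cl:
  "\<alpha> \<in> meet_join_cl Cp Cm R \<Longrightarrow> prod.swap \<alpha> \<in> meet_join_cl Cm Cp (R\<inverse>)"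
  by (induction rule: meet_join_cl.induct)
    (auto simp: swap_simps intro: meet_join_cl.intros swap_emb_rel)

lemma swap_meet_Join_cl:
  assumes "\<alpha> \<in> meet_Join_cl Cp Cm R"
  shows "prod.swap \<alpha> \<in> join_Meet_cl Cm Cp (R\<inverse>)"
proof -
  obtain A where A: "\<alpha> = (c_Sup Cp (fst ` A), \<Inter>(snd ` A))" "A \<subseteq> meet_cl Cp Cm R"
    using assms by (auto simp: meet_Join_cl_def)
  have "prod.swap \<alpha> = (\<Inter>(fst ` prod.swap ` A), c_Sup Cp (snd ` prod.swap ` A))"
    by (simp add: A(1) image_image)
  moreover have "prod.swap ` A \<subseteq> join_cl Cm Cp (R\<inverse>)"
    using A(2) swap_meet_cl by blast
  ultimately show ?thesis
    unfolding join_Meet_cl_def by blast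
qed

lemma swap_Tot: "\<alpha> \<in> Tot Cp Cm R \<Longrightarrow> prod.swap \<alpha> \<in> Tot Cm Cp (R\<inverse>)"
proof (induction rule: Tot.induct)
  case (up \<beta> \<alpha>)
  then show ?case by (meson Tot.up swap_dpairs swap_info_le)
qed (auto simp: swap_simps intro: Tot.intros swap_emb_rel)

text \<open>Turns (ind$_-$) into (ind$_+$) for the swapped presentation.\<close>

lemma swap_ind:
  assumes "emb_rel Cp Cm UNIV \<inter> info_down Cp Cm (join_Meet_cl Cp Cm R)
    \<subseteq> info_down Cp Cm (meet_join_cl Cp Cm R)"
  shows "emb_rel Cm Cp UNIV \<inter> info_down Cm Cp (meet_Join_cl Cm Cp (R\<inverse>))
    \<subseteq> info_down Cm Cp (meet_join_cl Cm Cp (R\<inverse>))"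
proof
  fix \<alpha> assume \<alpha>: "\<alpha> \<in> emb_rel Cm Cp UNIV \<inter> info_down Cm Cp (meet_Join_cl Cm Cp (R\<inverse>))"
  then obtain \<beta> where \<beta>: "\<beta> \<in> meet_Join_cl Cm Cp (R\<inverse>)" "\<alpha> \<sqsubseteq> \<beta>" and d: "\<alpha> \<in> dpairs Cm Cp"
    by (auto simp: info_down_def)
  have "prod.swap \<alpha> \<in> emb_rel Cp Cm UNIV"
    using \<alpha> swap_emb_rel[of \<alpha> Cm Cp UNIV] by simp
  moreover have "prod.swap \<alpha> \<in> info_down Cp Cm (join_Meet_cl Cp Cm R)"
    using swap_meet_Join_cl[OF \<beta>(1)] \<beta>(2) swap_dpairs[OF d]
    by (auto simp: info_down_def swap_info_le simp del: swap_simp intro!: bexI[of _ "prod.swap \<beta>"])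
  ultimately obtain \<gamma> where "\<gamma> \<in> meet_join_cl Cp Cm R" "prod.swap \<alpha> \<sqsubseteq> \<gamma>"
    using assms by (auto simp: info_down_def)
  then have "prod.swap \<gamma> \<in> meet_join_cl Cm Cp (R\<inverse>)" "\<alpha> \<sqsubseteq> prod.swap \<gamma>"
    using swap_meet_join_cl[of \<gamma> Cp Cm R] swap_info_le[of "prod.swap \<alpha>" \<gamma>] by auto
  then show "\<alpha> \<in> info_down Cm Cp (meet_join_cl Cm Cp (R\<inverse>))"
    using d by (auto simp: info_down_def)
qed


subsection \<open>Consistent pairs of generators\<close>

text \<open>Equivalently, by \<open>emb_mem_info_down_iff\<close>, the pair of principal ideals of
  \<open>x\<close> and \<open>y\<close> lies in the information-downward closure of
  \<open>meet_join_cl\<close>.\<close>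

definition consistent ::
  "('a::bounded_semilattice_inf_top set \<times> 'a) set \<Rightarrow> ('b::bounded_semilattice_inf_top set \<times> 'b) set
    \<Rightarrow> ('a \<times> 'b) set \<Rightarrow> 'a \<Rightarrow> 'b \<Rightarrow> bool" where
  "consistent Cp Cm R x y \<longleftrightarrow> (\<exists>\<gamma>\<in>meet_join_cl Cp Cm R. x \<in> fst \<gamma> \<and> y \<in> snd \<gamma>)"

lemma consistent_swap: "consistent Cm Cp (R\<inverse>) y x \<longleftrightarrow> consistent Cp Cm R x y"
proof -
  \<comment> \<open>One implication for arbitrary types, so that it can also be instantiated with
    the two sides exchanged.\<close>
  have "consistent Cm Cp (R\<inverse>) y x" if "consistent Cp Cm R x y"
    for Cp Cm R and x :: "'c::bounded_semilattice_inf_top" and y :: "'d::bounded_semilattice_inf_top"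
    using that swap_meet_join_cl by (force simp: consistent_def)
  from this[of Cp Cm R x y] this[of Cm Cp "R\<inverse>" y x] show ?thesis by auto
qed

text \<open>Choose a witness for every \<open>u\<close>. Through their normal forms these lie in
  \<open>meet_Join_cl\<close>, which is closed under arbitrary logical joins; \<open>y\<close>
  survives because it lies in every second component.\<close>

lemma consistent_Join:
  assumes fp: "frame_presentation Cp" "frame_presentation Cm"
    and U: "\<And>u. u \<in> U \<Longrightarrow> consistent Cp Cm R u y"
  shows "\<exists>\<gamma>\<in>meet_Join_cl Cp Cm R. U \<subseteq> fst \<gamma> \<and> y \<in> snd \<gamma>"
proof -
  obtain f where f: "\<And>u. u \<in> U \<Longrightarrow> f u \<in> meet_join_cl Cp Cm R"
      "\<And>u. u \<in> U \<Longrightarrow> u \<in> fst (f u)" "\<And>u. u \<in> U \<Longrightarrow> y \<in> snd (f u)"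
    using U unfolding consistent_def by metis
  have "f ` U \<subseteq> meet_Join_cl Cp Cm R"
    using f(1) meet_join_cl_subset_dnf_cl[OF fp] dnf_cl_subset_meet_Join_cl by blast
  then have "(c_Sup Cp (fst ` f ` U), \<Inter>(snd ` f ` U)) \<in> meet_Join_cl Cp Cm R"
    by (rule meet_Join_cl_Join)
  moreover have "U \<subseteq> c_Sup Cp (fst ` f ` U)"
    using f(2) c_Sup_upper[of _ "fst ` f ` U" Cp] by blast
  ultimately show ?thesis
    using f(3) by (intro bexI) auto
qed

text \<open>For a cover of \<open>a\<close>, the joined witness contains the whole cover and hence
  \<open>a\<close>, but it is an infinite join in general; (ind$_+$) replaces it by a finite
  combination.\<close>

lemma c_ideal_consistent_fst:
  assumes fp: "frame_presentation Cp" "frame_presentation Cm"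
    and ind: "emb_rel Cp Cm UNIV \<inter> info_down Cp Cm (meet_Join_cl Cp Cm R)
      \<subseteq> info_down Cp Cm (meet_join_cl Cp Cm R)"
  shows "c_ideal Cp {x. consistent Cp Cm R x y}"
proof (rule c_idealI)
  fix x x' assume "x \<in> {x. consistent Cp Cm R x y}" "x' \<le> x"
  then show "x' \<in> {x. consistent Cp Cm R x y}"
    using meet_join_cl_dpairs unfolding consistent_def dpairs_iff by (blast dest: c_ideal_downD)
next
  fix U a assume Ua: "(U, a) \<in> Cp" and U: "U \<subseteq> {x. consistent Cp Cm R x y}"
  then obtain \<gamma> where \<gamma>: "\<gamma> \<in> meet_Join_cl Cp Cm R" "U \<subseteq> fst \<gamma>" "y \<in> snd \<gamma>"
    using consistent_Join[OF fp, of U R y] by blast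
  have "a \<in> fst \<gamma>"
    using c_ideal_coverD[OF _ Ua \<gamma>(2)] meet_Join_cl_dpairs[OF \<gamma>(1)] by (simp add: dpairs_iff)
  then have "(c_emb Cp a, c_emb Cm y) \<in> info_down Cp Cm (meet_Join_cl Cp Cm R)"
    using \<gamma> emb_mem_info_down_iff[of "meet_Join_cl Cp Cm R" Cp Cm a y] meet_Join_cl_dpairs by blast
  moreover have "(c_emb Cp a, c_emb Cm y) \<in> emb_rel Cp Cm UNIV"
    by (auto simp: emb_rel_def)
  ultimately have "(c_emb Cp a, c_emb Cm y) \<in> info_down Cp Cm (meet_join_cl Cp Cm R)"
    using ind by blast
  then show "a \<in> {x. consistent Cp Cm R x y}"
    using emb_mem_info_down_iff[of "meet_join_cl Cp Cm R" Cp Cm a y] meet_join_cl_dpairs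
    unfolding consistent_def by blast
qed

lemma c_ideal_consistent_snd:
  assumes fp: "frame_presentation Cp" "frame_presentation Cm"
    and ind: "emb_rel Cp Cm UNIV \<inter> info_down Cp Cm (join_Meet_cl Cp Cm R)
      \<subseteq> info_down Cp Cm (meet_join_cl Cp Cm R)"
  shows "c_ideal Cm {y. consistent Cp Cm R x y}"
  using c_ideal_consistent_fst[OF fp(2,1) swap_ind[OF ind], of x] by (simp add: consistent_swap)

lemma Con_consistent:
  assumes fp: "frame_presentation Cp" "frame_presentation Cm"
    and ind_plus: "emb_rel Cp Cm UNIV \<inter> info_down Cp Cm (meet_Join_cl Cp Cm R)
      \<subseteq> info_down Cp Cm (meet_join_cl Cp Cm R)"
    and ind_minus: "emb_rel Cp Cm UNIV \<inter> info_down Cp Cm (join_Meet_cl Cp Cm R)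
      \<subseteq> info_down Cp Cm (meet_join_cl Cp Cm R)"
    and "\<alpha> \<in> Con Cp Cm R" and "x \<in> fst \<alpha>" and "y \<in> snd \<alpha>"
  shows "consistent Cp Cm R x y"
proof -
  note ideal_fst = c_ideal_consistent_fst[OF fp ind_plus]
  note ideal_snd = c_ideal_consistent_snd[OF fp ind_minus]
  \<comment> \<open>With one element fixed, consistency extends from generators to the ideal they
    generate, since the consistent elements form an ideal.\<close>
  have Sup_fst: "consistent Cp Cm R x y"
    if "x \<in> c_Sup Cp F" "\<And>I z. I \<in> F \<Longrightarrow> z \<in> I \<Longrightarrow> consistent Cp Cm R z y" for F x y
    using c_Sup_least[OF ideal_fst, of F y] that by blast
  have Sup_snd: "consistent Cp Cm R x y"
    if "y \<in> c_Sup Cm F" "\<And>I z. I \<in> F \<Longrightarrow> z \<in> I \<Longrightarrow> consistent Cp Cm R x z" for F x y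
    using c_Sup_least[OF ideal_snd, of F x] that by blast
  show ?thesis
    using assms(5-7)
  proof (induction arbitrary: x y)
    case (gen \<alpha>)
    then show ?case using meet_join_cl.gen unfolding consistent_def by blast
  next
    case tt
    then show ?case using meet_join_cl.tt unfolding consistent_def by blast
  next
    case ff
    then show ?case using meet_join_cl.ff unfolding consistent_def by blast
  next
    case (down \<beta> \<alpha>)
    then show ?case by (auto simp: info_le_def)
  next
    case (meet \<alpha> \<beta>)
    then show ?case by (auto simp: log_meet_def intro: Sup_snd)
  next
    case (join \<alpha> \<beta>)
    then show ?case by (auto simp: log_join_def intro: Sup_fst)
  next
    case (directed D)
    \<comment> \<open>The two elements may come from different members of \<open>D\<close>;
      directedness puts both into a single member, to which the induction hypothesis
      applies.\<close>
    have pair: "consistent Cp Cm R u v" if \<delta>: "\<delta> \<in> D" "u \<in> fst \<delta>" and \<epsilon>: "\<epsilon> \<in> D" "v \<in> snd \<epsilon>" for u v \<delta> \<epsilon>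
    proof -
      obtain \<gamma> where "\<gamma> \<in> D" "\<delta> \<sqsubseteq> \<gamma>" "\<epsilon> \<sqsubseteq> \<gamma>"
        using directed.hyps \<delta>(1) \<epsilon>(1) unfolding info_directed_def by blast
      then show ?thesis
        using directed.IH[of \<gamma> u v] \<delta>(2) \<epsilon>(2) by (auto simp: info_le_def)
    qed
    \<comment> \<open>The joins are treated one coordinate at a time: first \<open>x\<close> with
      \<open>v\<close> fixed, then \<open>y\<close> with \<open>x\<close> fixed.\<close>
    have "consistent Cp Cm R x v" if "\<epsilon> \<in> D" "v \<in> snd \<epsilon>" for v \<epsilon>
      using directed.prems(1) Sup_fst[of x "fst ` D" v] pair[OF _ _ that] by fastforce
    then show ?case
      using directed.prems(2) Sup_snd[of y "snd ` D" x] by fastforce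
  qed
qed

text \<open>Asking for elementwise consistency of \<open>\<alpha>\<close> rather than membership in
  \<open>Con\<close> lets the lemma be reused for the swapped pair by means of
  \<open>consistent_swap\<close>.\<close>

lemma consistent_Tot_plus:
  assumes fp: "frame_presentation Cp" "frame_presentation Cm"
    and lambda: "\<And>\<alpha> \<beta>. \<alpha> \<in> meet_Join_cl Cp Cm R \<Longrightarrow> \<beta> \<in> meet_cl Cp Cm T \<Longrightarrow>
      fst \<beta> \<subseteq> fst \<alpha> \<Longrightarrow> snd \<alpha> \<subseteq> snd \<beta>"
    and consistent: "\<And>x y. x \<in> fst \<alpha> \<Longrightarrow> y \<in> snd \<alpha> \<Longrightarrow> consistent Cp Cm R x y"
    and \<beta>: "\<beta> \<in> Tot Cp Cm T" and le: "fst \<beta> \<subseteq> fst \<alpha>"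
  shows "snd \<alpha> \<subseteq> snd \<beta>"
proof -
  have "snd \<alpha> \<subseteq> snd \<gamma>" if "\<gamma> \<in> dnf_cl Cp Cm T" "fst \<gamma> \<subseteq> fst \<alpha>" for \<gamma>
    using that
  proof induction
    case (base \<gamma>)
    show ?case
    proof
      fix y assume y: "y \<in> snd \<alpha>"
      \<comment> \<open>The witness \<open>\<delta>\<close> depends on \<open>y\<close>. As
        \<open>fst \<gamma> \<subseteq> fst \<alpha> \<subseteq> fst \<delta>\<close>, the
        hypothesis (lambda) carries \<open>y\<close> from \<open>snd \<delta>\<close> to
        \<open>snd \<gamma>\<close>.\<close>
      obtain \<delta> where "\<delta> \<in> meet_Join_cl Cp Cm R" "fst \<alpha> \<subseteq> fst \<delta>" "y \<in> snd \<delta>"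
        using consistent_Join[OF fp consistent[OF _ y]] by blast
      then show "y \<in> snd \<gamma>"
        using lambda[OF _ base(1), of \<delta>] base(2) by blast
    qed
  next
    case ff
    then show ?case by (simp add: ff_def)
  next
    \<comment> \<open>Both first components lie below their join, hence below
      \<open>fst \<alpha>\<close>; the second component is an intersection, so the two induction
      hypotheses combine.\<close>
    case (join \<gamma> \<delta>)
    then show ?case
      using c_Sup_pair_upper[of "fst \<gamma>" Cp "fst \<delta>"] c_Sup_pair_upper(2)[of "fst \<delta>" Cp "fst \<gamma>"]
      by (auto simp: log_join_def)
  qed
  then show ?thesis
    using Tot_above_dnf_cl[OF fp \<beta>] le unfolding info_le_def by blast
qed

theorem theorem16:
  fixes Cp :: "('a::bounded_semilattice_inf_top set \<times> 'a) set"
    and Cm :: "('b::bounded_semilattice_inf_top set \<times> 'b) set"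
    and con1 tot1 :: "('a \<times> 'b) set"
  assumes "frame_presentation Cp" and "frame_presentation Cm"
    and lambda4_plus: "\<And>\<alpha> \<beta>. \<alpha> \<in> meet_Join_cl Cp Cm con1 \<Longrightarrow> \<beta> \<in> meet_cl Cp Cm tot1 \<Longrightarrow>
           fst \<beta> \<subseteq> fst \<alpha> \<Longrightarrow> snd \<alpha> \<subseteq> snd \<beta>"
    and lambda4_minus: "\<And>\<alpha> \<beta>. \<alpha> \<in> join_Meet_cl Cp Cm con1 \<Longrightarrow> \<beta> \<in> join_cl Cp Cm tot1 \<Longrightarrow>
           snd \<beta> \<subseteq> snd \<alpha> \<Longrightarrow> fst \<alpha> \<subseteq> fst \<beta>"
    and ind_plus: "emb_rel Cp Cm UNIV \<inter> info_down Cp Cm (meet_Join_cl Cp Cm con1)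
           \<subseteq> info_down Cp Cm (meet_join_cl Cp Cm con1)"
    and ind_minus: "emb_rel Cp Cm UNIV \<inter> info_down Cp Cm (join_Meet_cl Cp Cm con1)
           \<subseteq> info_down Cp Cm (meet_join_cl Cp Cm con1)"
  shows "\<forall>\<alpha> \<in> Con Cp Cm con1. \<forall>\<beta> \<in> Tot Cp Cm tot1.
           fst \<alpha> = fst \<beta> \<or> snd \<alpha> = snd \<beta> \<longrightarrow> \<alpha> \<sqsubseteq> \<beta>"
proof (intro ballI impI)
  fix \<alpha> \<beta> assume \<alpha>: "\<alpha> \<in> Con Cp Cm con1" and \<beta>: "\<beta> \<in> Tot Cp Cm tot1"
    and eq: "fst \<alpha> = fst \<beta> \<or> snd \<alpha> = snd \<beta>"
  have consistent: "consistent Cp Cm con1 x y" if "x \<in> fst \<alpha>" "y \<in> snd \<alpha>" for x y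
    using Con_consistent[OF assms(1,2) ind_plus ind_minus \<alpha> that] .
  have plus: "snd \<alpha> \<subseteq> snd \<beta>" if "fst \<beta> \<subseteq> fst \<alpha>"
    using consistent_Tot_plus[OF assms(1-3) consistent \<beta> that] .
  have lambda_swap: "snd \<gamma> \<subseteq> snd \<delta>"
    if "\<gamma> \<in> meet_Join_cl Cm Cp (con1\<inverse>)" "\<delta> \<in> meet_cl Cm Cp (tot1\<inverse>)" "fst \<delta> \<subseteq> fst \<gamma>" for \<gamma> \<delta>
    using lambda4_minus[of "prod.swap \<gamma>" "prod.swap \<delta>"]
      swap_meet_Join_cl[OF that(1)] swap_meet_cl[OF that(2)] that(3) by simp
  have minus: "fst \<alpha> \<subseteq> fst \<beta>" if "snd \<beta> \<subseteq> snd \<alpha>"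
    using consistent_Tot_plus[OF assms(2,1) lambda_swap _ swap_Tot[OF \<beta>], of "con1\<inverse>" "prod.swap \<alpha>"]
      consistent that by (simp add: consistent_swap)
  \<comment> \<open>Equality in one component gives that inclusion outright, and \<open>plus\<close>
    or \<open>minus\<close> supplies the other.\<close>
  show "\<alpha> \<sqsubseteq> \<beta>"
    using plus minus eq by (auto simp: info_le_def)
qed

end
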